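(* Consider the binary relations $\mid_L$, $\mid_R$, $\mid_M$, $\leq_{fe}$ and $\widetilde{\mid}$ on $\beta\mathbb{N}$ as sets of ordered pairs of ultrafilters. Then the following strict inclusions hold: $$\mid_L\;\subset\;\mid_M,\qquad \mid_R\;\subset\;\mid_M,\qquad \mid_M\;\subset\;\leq_{fe}\;\subset\;\widetilde{\mid}.$$
   Context: $\mathbb{N}$ is the set of positive integers and $\beta\mathbb{N}$ is the set of all ultrafilters on $\mathbb{N}$; each $n\in\mathbb{N}$ is identified with the principal ultrafilter $\{A\subseteq\mathbb{N}:n\in A\}$. For $A\subseteq\mathbb{N}$ and $n\in\mathbb{N}$ put $A/n=\{a/n:a\in A,\ n\mid a\}$, and for $\mathcal{F},\mathcal{G}\in\beta\mathbb{N}$ put $\mathcal{F}\cdot\mathcal{G}=\{A\subseteq\mathbb{N}:\{n\in\mathbb{N}:A/n\in\mathcal{G}\}\in\mathcal{F}\}$; this is an associative operation on $\beta\mathbb{N}$ extending multiplication. For $A\subseteq\mathbb{N}$, $A\!\uparrow\;=\{n\in\mathbb{N}:(\exists a\in A)\ a\mid n\}$ and, for $k\in\mathbb{N}$, $kA=\{ka:a\in A\}$. For $\mathcal{F},\mathcal{G}\in\beta\mathbb{N}$: - $\mathcal{F}\mid_L\mathcal{G}$ if $\mathcal{G}=\mathcal{H}\cdot\mathcal{F}$ for some $\mathcal{H}\in\beta\mathbb{N}$; - $\mathcal{F}\mid_R\mathcal{G}$ if $\mathcal{G}=\mathcal{F}\cdot\mathcal{H}$ for some $\mathcal{H}\in\beta\mathbb{N}$;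 - $\mathcal{F}\mid_M\mathcal{G}$ if $\mathcal{G}=\mathcal{H}_1\cdot\mathcal{F}\cdot\mathcal{H}_2$ for some $\mathcal{H}_1,\mathcal{H}_2\in\beta\mathbb{N}$; - $\mathcal{F}\,\widetilde{\mid}\,\mathcal{G}$ if $A\!\uparrow\;\in\mathcal{G}$ for every $A\in\mathcal{F}$; - $\mathcal{F}\leq_{fe}\mathcal{G}$ if for every $B\in\mathcal{G}$ there is $A\in\mathcal{F}$ with $A\leq_{fe}B$, where for $A,B\subseteq\mathbb{N}$, $A\leq_{fe}B$ means that for every finite $F\subseteq A$ there is $k\in\mathbb{N}$ with $kF\subseteq B$. *)

theory Defs
  imports Main
begin

text \<open>The natural numbers considered here start at 1. Subsets of it are represented as
  elements of type \<^typ>\<open>nat set\<close>, and ultrafilters on it as families of such subsets.\<close>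

definition Npos :: "nat set" where
  "Npos = {0<..}"

definition ultrafilter_on :: "'a set \<Rightarrow> 'a set set \<Rightarrow> bool" where
  "ultrafilter_on X \<F> \<longleftrightarrow>
     \<F> \<subseteq> Pow X \<and> X \<in> \<F> \<and> {} \<notin> \<F> \<and>
     (\<forall>A\<in>\<F>. \<forall>B\<in>\<F>. A \<inter> B \<in> \<F>) \<and>
     (\<forall>A\<in>\<F>. \<forall>B. A \<subseteq> B \<and> B \<subseteq> X \<longrightarrow> B \<in> \<F>) \<and>
     (\<forall>A. A \<subseteq> X \<longrightarrow> A \<in> \<F> \<or> X - A \<in> \<F>)"

definition betaN :: "nat set set set" where
  "betaN = {\<F>. ultrafilter_on Npos \<F>}"

text \<open>All operations below are only used for \<^term>\<open>n \<in> Npos\<close> and \<^term>\<open>A \<subseteq> Npos\<close>;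
  under these assumptions the divisions in \<open>set_quot\<close> are exact and its values are
  again subsets of \<^const>\<open>Npos\<close>.\<close>

definition set_quot :: "nat set \<Rightarrow> nat \<Rightarrow> nat set" where
  "set_quot A n = {a div n | a. a \<in> A \<and> n dvd a}"

definition uprod :: "nat set set \<Rightarrow> nat set set \<Rightarrow> nat set set" (infixl "\<odot>" 70) where
  "\<F> \<odot> \<G> = {A. A \<subseteq> Npos \<and> {n \<in> Npos. set_quot A n \<in> \<G>} \<in> \<F>}"

definition up_set :: "nat set \<Rightarrow> nat set" where
  "up_set A = {n \<in> Npos. \<exists>a\<in>A. a dvd n}"

definition fe_set :: "nat set \<Rightarrow> nat set \<Rightarrow> bool" where
  "fe_set A B \<longleftrightarrow> (\<forall>F. finite F \<and> F \<subseteq> A \<longrightarrow> (\<exists>k\<in>Npos. (\<lambda>a. k * a) ` F \<subseteq> B))"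

definition div_L :: "(nat set set \<times> nat set set) set" where
  "div_L = {(\<F>, \<G>). \<F> \<in> betaN \<and> \<G> \<in> betaN \<and> (\<exists>\<H>\<in>betaN. \<G> = \<H> \<odot> \<F>)}"

definition div_R :: "(nat set set \<times> nat set set) set" where
  "div_R = {(\<F>, \<G>). \<F> \<in> betaN \<and> \<G> \<in> betaN \<and> (\<exists>\<H>\<in>betaN. \<G> = \<F> \<odot> \<H>)}"

definition div_M :: "(nat set set \<times> nat set set) set" where
  "div_M = {(\<F>, \<G>). \<F> \<in> betaN \<and> \<G> \<in> betaN \<and>
     (\<exists>\<H>\<^sub>1\<in>betaN. \<exists>\<H>\<^sub>2\<in>betaN. \<G> = \<H>\<^sub>1 \<odot> \<F> \<odot> \<H>\<^sub>2)}"

definition div_tilde :: "(nat set set \<times> nat set set) set" where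
  "div_tilde = {(\<F>, \<G>). \<F> \<in> betaN \<and> \<G> \<in> betaN \<and> (\<forall>A\<in>\<F>. up_set A \<in> \<G>)}"

definition fe_rel :: "(nat set set \<times> nat set set) set" where
  "fe_rel = {(\<F>, \<G>). \<F> \<in> betaN \<and> \<G> \<in> betaN \<and> (\<forall>B\<in>\<G>. \<exists>A\<in>\<F>. fe_set A B)}"

end

theory Submission
  imports Defs "HOL-Computational_Algebra.Primes"
begin

text \<open>
An ultrafilter \<open>\<F>\<close> is read as a quantifier: ``for \<open>\<F>\<close>-most \<open>n\<close>''. Like any filter it commutes
with finite conjunctions, and being an ultrafilter it also commutes with negation, hence with
finite disjunctions. A set \<open>A\<close> belongs to \<open>\<F> \<odot> \<G>\<close> iff for \<open>\<F>\<close>-most \<open>n\<close> and then for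
\<open>\<G>\<close>-most \<open>m\<close> the product \<open>n * m\<close> lies in \<open>A\<close>. Since the two quantifiers do not commute, sets that
force one factor to be large compared with the other tell the products apart.

The inclusions are short. One-sided divisibility is two-sided divisibility with the principal
ultrafilter at 1 as the other factor. If \<open>\<G> = \<H>1 \<odot> \<F> \<odot> \<H>2\<close> and \<open>B \<in> \<G>\<close>, fix one \<open>n\<close> from the
outermost quantifier; then \<open>\<F>\<close>-most \<open>a\<close> have \<open>n * a * m \<in> B\<close> for \<open>\<H>2\<close>-most \<open>m\<close>, so finitely many
such \<open>a\<close> share a multiplier \<open>n * m\<close>. Finally, a set that \<open>A\<close> embeds into finitely contains a multiple
of each element of \<open>A\<close>, so it cannot avoid the set of multiples of the elements of a set in \<open>\<F>\<close>.

For strictness, let \<open>\<F>\<close> be a free ultrafilter on the primes (\<open>free_on_primes_exists\<close>) and \<open>\<H>\<close> its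
image under \<open>y \<mapsto> 2 ^ y\<close>.

 \<^item> \<open>\<F> \<odot> \<H>\<close> contains the set of all \<open>a * 2 ^ y\<close> with \<open>a < y\<close>. In a product \<open>\<H>' \<odot> \<F>\<close> the factor
   from \<open>\<F>\<close> is an odd prime chosen after the other factor \<open>n\<close>, so the power of 2 would have to
   divide \<open>n\<close> and could not outgrow that prime. Hence \<open>\<F>\<close> divides \<open>\<F> \<odot> \<H>\<close> on the right only.

 \<^item> \<open>\<H> \<odot> \<F>\<close> contains the sets of all \<open>2 ^ y * b\<close> with \<open>b\<close> prime and \<open>t < y < b\<close>. In a product
   \<open>\<F> \<odot> \<H>'\<close> they force the prime to be the factor from \<open>\<F>\<close>, so \<open>\<H>'\<close> would live on powers of 2 that
   are bounded by a fixed prime and at the same time, by choosing \<open>t\<close>, beyond it. Hence \<open>\<F>\<close> divides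
   \<open>\<H> \<odot> \<F>\<close> on the left only.

 \<^item> Finite embeddability is preserved under limits: if \<open>\<F>\<close> embeds into each \<open>\<G>\<^sub>p\<close>, then
   it embeds into every limit of the \<open>\<G>\<^sub>p\<close>. Two-sided divisibility is not preserved. The witness is the
   limit over \<open>p\<close> of \<open>\<F> \<odot> \<K>\<^sub>p\<close>, where \<open>\<K>\<^sub>p\<close> is the image of \<open>\<F>\<close> under \<open>y \<mapsto> p ^ y\<close>. If it were
   \<open>\<H>1 \<odot> \<F> \<odot> \<H>2\<close>, then \<open>tower_cofactor\<close> and the pigeonhole principle would produce one prime \<open>q\<close>
   such that \<open>\<H>2\<close>-most \<open>m\<close> are nontrivial powers of \<open>q\<close>, although \<open>q\<close> can be required to
   exceed any given bound.

 \<^item> The image of \<open>\<F>\<close> under squaring is above \<open>\<F>\<close> for the tilde-divisibility. It contains the set of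
   squares of primes, into which no set with two primes embeds: if \<open>k * r\<close> is the square of a
   prime and \<open>r\<close> is prime, then \<open>k = r\<close>.
\<close>

section \<open>Ultrafilters as quantifiers\<close>

definition ufilt :: "nat set set \<Rightarrow> nat filter" where
  "ufilt \<F> = Abs_filter (\<lambda>P. {n \<in> Npos. P n} \<in> \<F>)"

lemma betaND:
  assumes "\<F> \<in> betaN"
  shows "A \<in> \<F> \<Longrightarrow> A \<subseteq> Npos" "Npos \<in> \<F>" "{} \<notin> \<F>"
    "A \<in> \<F> \<Longrightarrow> B \<in> \<F> \<Longrightarrow> A \<inter> B \<in> \<F>"
    "A \<in> \<F> \<Longrightarrow> A \<subseteq> B \<Longrightarrow> B \<subseteq> Npos \<Longrightarrow> B \<in> \<F>"
    "A \<subseteq> Npos \<Longrightarrow> A \<notin> \<F> \<Longrightarrow> Npos - A \<in> \<F>"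
proof -
  have U: "\<F> \<subseteq> Pow Npos" "Npos \<in> \<F>" "{} \<notin> \<F>" "\<forall>A\<in>\<F>. \<forall>B\<in>\<F>. A \<inter> B \<in> \<F>"
    "\<forall>A\<in>\<F>. \<forall>B. A \<subseteq> B \<and> B \<subseteq> Npos \<longrightarrow> B \<in> \<F>"
    "\<forall>A. A \<subseteq> Npos \<longrightarrow> A \<in> \<F> \<or> Npos - A \<in> \<F>"
    using assms unfolding betaN_def ultrafilter_on_def by simp_all
  show "A \<in> \<F> \<Longrightarrow> A \<subseteq> Npos" using U(1) by blast
  show "Npos \<in> \<F>" "{} \<notin> \<F>" using U(2,3) .
  show "A \<in> \<F> \<Longrightarrow> B \<in> \<F> \<Longrightarrow> A \<inter> B \<in> \<F>" using U(4) by simp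
  show "A \<in> \<F> \<Longrightarrow> A \<subseteq> B \<Longrightarrow> B \<subseteq> Npos \<Longrightarrow> B \<in> \<F>" using U(5) by simp
  show "A \<subseteq> Npos \<Longrightarrow> A \<notin> \<F> \<Longrightarrow> Npos - A \<in> \<F>" using U(6) by blast
qed

lemma eventually_ufilt:
  assumes "\<F> \<in> betaN"
  shows "(\<forall>\<^sub>F n in ufilt \<F>. P n) \<longleftrightarrow> {n \<in> Npos. P n} \<in> \<F>"
  unfolding ufilt_def
proof (rule eventually_Abs_filter, unfold_locales)
  show "{n \<in> Npos. True} \<in> \<F>"
    using betaND(2)[OF assms] by simp
  show "{n \<in> Npos. P n \<and> Q n} \<in> \<F>"
    if "{n \<in> Npos. P n} \<in> \<F>" "{n \<in> Npos. Q n} \<in> \<F>" for P Q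
  proof -
    have "{n \<in> Npos. P n \<and> Q n} = {n \<in> Npos. P n} \<inter> {n \<in> Npos. Q n}" by blast
    then show ?thesis using betaND(4)[OF assms that] by simp
  qed
  show "{n \<in> Npos. Q n} \<in> \<F>"
    if "\<forall>n. P n \<longrightarrow> Q n" "{n \<in> Npos. P n} \<in> \<F>" for P Q
    by (rule betaND(5)[OF assms that(2)]) (use that(1) in auto)
qed

lemma mem_iff_eventually:
  assumes "\<F> \<in> betaN"
  shows "A \<in> \<F> \<longleftrightarrow> A \<subseteq> Npos \<and> (\<forall>\<^sub>F n in ufilt \<F>. n \<in> A)"
proof (cases "A \<subseteq> Npos")
  case True
  then have "{n \<in> Npos. n \<in> A} = A" by blast
  then show ?thesis using True eventually_ufilt[OF assms, of "\<lambda>n. n \<in> A"] by simp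
qed (use betaND(1)[OF assms] in blast)

lemma eventually_pos:
  assumes "\<F> \<in> betaN"
  shows "\<forall>\<^sub>F n in ufilt \<F>. 0 < n"
  using betaND(2)[OF assms] by (simp add: eventually_ufilt[OF assms] Npos_def greaterThan_def)

lemma ufilt_neq_bot:
  assumes "\<F> \<in> betaN"
  shows "ufilt \<F> \<noteq> bot"
  using betaND(3)[OF assms] by (auto simp: trivial_limit_def eventually_ufilt[OF assms])

lemma eventually_ufilt_ex:
  assumes "\<F> \<in> betaN" "\<forall>\<^sub>F n in ufilt \<F>. P n"
  obtains n where "0 < n" "P n"
proof -
  have "\<forall>\<^sub>F n in ufilt \<F>. 0 < n \<and> P n"
    using eventually_pos[OF assms(1)] assms(2) by (rule eventually_conj)
  then show thesis
    using that eventually_happens'[OF ufilt_neq_bot[OF assms(1)]] by blast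
qed

lemma eventually_ufilt_not:
  assumes "\<F> \<in> betaN"
  shows "(\<forall>\<^sub>F n in ufilt \<F>. \<not> P n) \<longleftrightarrow> \<not> (\<forall>\<^sub>F n in ufilt \<F>. P n)"
proof
  assume "\<forall>\<^sub>F n in ufilt \<F>. \<not> P n"
  then show "\<not> (\<forall>\<^sub>F n in ufilt \<F>. P n)"
    using eventually_ufilt_ex[OF assms eventually_conj] by blast
next
  have "Npos - {n \<in> Npos. P n} = {n \<in> Npos. \<not> P n}" by blast
  moreover assume "\<not> (\<forall>\<^sub>F n in ufilt \<F>. P n)"
  ultimately show "\<forall>\<^sub>F n in ufilt \<F>. \<not> P n"
    using betaND(6)[OF assms, of "{n \<in> Npos. P n}"] by (simp add: eventually_ufilt[OF assms])
qed

text \<open>The pigeonhole principle for ultrafilters: \<^term>\<open>eventually\<close> commutes with finite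
  disjunctions because it commutes with negation and with finite conjunctions.\<close>

lemma eventually_ufilt_bex_finite:
  assumes "\<F> \<in> betaN" "finite I" "\<forall>\<^sub>F n in ufilt \<F>. \<exists>i\<in>I. P i n"
  obtains i where "i \<in> I" "\<forall>\<^sub>F n in ufilt \<F>. P i n"
proof -
  have "\<not> (\<forall>\<^sub>F n in ufilt \<F>. \<forall>i\<in>I. \<not> P i n)"
    using assms(3) eventually_ufilt_not[OF assms(1), of "\<lambda>n. \<exists>i\<in>I. P i n"] by simp
  then show thesis
    using that by (auto simp: eventually_ball_finite_distrib[OF assms(2)]
        eventually_ufilt_not[OF assms(1)])
qed

section \<open>Limits and products of ultrafilters\<close>

definition principal_uf :: "nat \<Rightarrow> nat set set" where
  "principal_uf k = {A. A \<subseteq> Npos \<and> k \<in> A}"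

text \<open>The limit of the ultrafilters \<open>g n\<close> along \<open>\<F>\<close> in the Stone topology of \<^const>\<open>betaN\<close>.\<close>

definition ulimit :: "nat set set \<Rightarrow> (nat \<Rightarrow> nat set set) \<Rightarrow> nat set set" where
  "ulimit \<F> g = {A. A \<subseteq> Npos \<and> (\<forall>\<^sub>F n in ufilt \<F>. A \<in> g n)}"

definition uimage :: "(nat \<Rightarrow> nat) \<Rightarrow> nat set set \<Rightarrow> nat set set" where
  "uimage f \<F> = ulimit \<F> (\<lambda>n. principal_uf (f n))"

lemma principal_uf_betaN: "0 < k \<Longrightarrow> principal_uf k \<in> betaN"
  by (auto simp: principal_uf_def betaN_def ultrafilter_on_def Npos_def)

lemma eventually_principal_uf:
  "0 < k \<Longrightarrow> (\<forall>\<^sub>F n in ufilt (principal_uf k). P n) \<longleftrightarrow> P k"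
  by (auto simp: eventually_ufilt[OF principal_uf_betaN]) (auto simp: principal_uf_def Npos_def)

lemma ulimit_betaN:
  assumes F: "\<F> \<in> betaN" and g: "\<And>n. 0 < n \<Longrightarrow> g n \<in> betaN"
  shows "ulimit \<F> g \<in> betaN"
proof -
  have ev: "\<forall>\<^sub>F n in ufilt \<F>. g n \<in> betaN"
    using eventually_pos[OF F] by eventually_elim (rule g)
  have "Npos \<in> ulimit \<F> g"
    using ev by (auto simp: ulimit_def elim!: eventually_mono intro: betaND(2))
  moreover have "{} \<notin> ulimit \<F> g"
  proof
    assume "{} \<in> ulimit \<F> g"
    then have "\<forall>\<^sub>F n in ufilt \<F>. {} \<in> g n" by (simp add: ulimit_def)
    with F obtain n where "0 < n" "{} \<in> g n" by (rule eventually_ufilt_ex)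
    then show False using g betaND(3) by blast
  qed
  moreover have "A \<inter> B \<in> ulimit \<F> g" if "A \<in> ulimit \<F> g" "B \<in> ulimit \<F> g" for A B
  proof -
    have "\<forall>\<^sub>F n in ufilt \<F>. A \<in> g n" "\<forall>\<^sub>F n in ufilt \<F>. B \<in> g n" and "A \<subseteq> Npos"
      using that by (auto simp: ulimit_def)
    moreover from this(1,2) ev have "\<forall>\<^sub>F n in ufilt \<F>. A \<inter> B \<in> g n"
      by eventually_elim (rule betaND(4))
    ultimately show ?thesis by (auto simp: ulimit_def)
  qed
  moreover have "B \<in> ulimit \<F> g" if "A \<in> ulimit \<F> g" "A \<subseteq> B" "B \<subseteq> Npos" for A B
  proof -
    have "\<forall>\<^sub>F n in ufilt \<F>. A \<in> g n" using that by (auto simp: ulimit_def)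
    with ev have "\<forall>\<^sub>F n in ufilt \<F>. B \<in> g n"
      by eventually_elim (rule betaND(5)[OF _ _ that(2,3)])
    then show ?thesis using that by (auto simp: ulimit_def)
  qed
  moreover have "A \<in> ulimit \<F> g \<or> Npos - A \<in> ulimit \<F> g" if "A \<subseteq> Npos" for A
  proof (subst disj_commute, rule disjCI)
    assume "A \<notin> ulimit \<F> g"
    then have "\<forall>\<^sub>F n in ufilt \<F>. A \<notin> g n"
      using that by (auto simp: ulimit_def eventually_ufilt_not[OF F])
    with ev have "\<forall>\<^sub>F n in ufilt \<F>. Npos - A \<in> g n"
      by eventually_elim (rule betaND(6)[OF _ that])
    then show "Npos - A \<in> ulimit \<F> g" by (auto simp: ulimit_def)
  qed
  moreover have "ulimit \<F> g \<subseteq> Pow Npos" by (auto simp: ulimit_def)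
  ultimately show ?thesis
    by (simp add: betaN_def ultrafilter_on_def)
qed

lemma eventually_ulimit:
  assumes F: "\<F> \<in> betaN" and g: "\<And>n. 0 < n \<Longrightarrow> g n \<in> betaN"
  shows "(\<forall>\<^sub>F x in ufilt (ulimit \<F> g). P x) \<longleftrightarrow> (\<forall>\<^sub>F n in ufilt \<F>. \<forall>\<^sub>F x in ufilt (g n). P x)"
proof -
  have "(\<forall>\<^sub>F x in ufilt (ulimit \<F> g). P x) \<longleftrightarrow> (\<forall>\<^sub>F n in ufilt \<F>. {x \<in> Npos. P x} \<in> g n)"
    by (subst eventually_ufilt[OF ulimit_betaN[OF F g]]) (auto simp: ulimit_def)
  also have "\<dots> \<longleftrightarrow> (\<forall>\<^sub>F n in ufilt \<F>. \<forall>\<^sub>F x in ufilt (g n). P x)"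
    by (intro eventually_cong[OF eventually_pos[OF F]]) (simp add: eventually_ufilt[OF g])
  finally show ?thesis .
qed

lemma uimage_betaN:
  assumes "\<F> \<in> betaN" "\<And>n. 0 < n \<Longrightarrow> 0 < f n"
  shows "uimage f \<F> \<in> betaN"
  unfolding uimage_def by (intro ulimit_betaN assms principal_uf_betaN)

lemma eventually_uimage:
  assumes F: "\<F> \<in> betaN" and f: "\<And>n. 0 < n \<Longrightarrow> 0 < f n"
  shows "(\<forall>\<^sub>F x in ufilt (uimage f \<F>). P x) \<longleftrightarrow> (\<forall>\<^sub>F n in ufilt \<F>. P (f n))"
  unfolding uimage_def
  by (subst eventually_ulimit[OF F principal_uf_betaN[OF f]], assumption)
     (intro eventually_cong[OF eventually_pos[OF F]], simp add: eventually_principal_uf f)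

lemma mem_set_quot_iff: "0 < n \<Longrightarrow> m \<in> set_quot A n \<longleftrightarrow> n * m \<in> A"
  by (auto simp: set_quot_def intro!: exI[of _ "n * m"])

lemma set_quot_subset: "A \<subseteq> Npos \<Longrightarrow> 0 < n \<Longrightarrow> set_quot A n \<subseteq> Npos"
  by (auto simp: set_quot_def Npos_def subset_iff dvd_def)

text \<open>The product is the iterated limit of the principal ultrafilters at \<open>n * m\<close>. Hence products
  are ultrafilters, and membership in them is an iterated quantifier.\<close>

lemma uprod_eq_ulimit:
  assumes F: "\<F> \<in> betaN" and G: "\<G> \<in> betaN"
  shows "\<F> \<odot> \<G> = ulimit \<F> (\<lambda>n. uimage ((*) n) \<G>)"
proof -
  have "set_quot A n \<in> \<G> \<longleftrightarrow> A \<in> uimage ((*) n) \<G>" if "A \<subseteq> Npos" "0 < n" for A n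
  proof -
    have "set_quot A n \<in> \<G> \<longleftrightarrow> (\<forall>\<^sub>F m in ufilt \<G>. n * m \<in> A)"
      using that set_quot_subset[OF that]
      by (simp add: mem_iff_eventually[OF G] mem_set_quot_iff)
    then show ?thesis using that
      by (simp add: mem_iff_eventually[OF uimage_betaN[OF G]] eventually_uimage[OF G])
  qed
  then show ?thesis
    unfolding uprod_def ulimit_def eventually_ufilt[OF F]
    by (auto simp: Npos_def elim!: back_subst[of "\<lambda>S. S \<in> \<F>"])
qed

lemma uprod_betaN:
  assumes F: "\<F> \<in> betaN" and G: "\<G> \<in> betaN"
  shows "\<F> \<odot> \<G> \<in> betaN"
  unfolding uprod_eq_ulimit[OF assms] by (intro ulimit_betaN uimage_betaN assms) auto

lemma eventually_uprod:
  assumes F: "\<F> \<in> betaN" and G: "\<G> \<in> betaN"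
  shows "(\<forall>\<^sub>F x in ufilt (\<F> \<odot> \<G>). P x) \<longleftrightarrow> (\<forall>\<^sub>F n in ufilt \<F>. \<forall>\<^sub>F m in ufilt \<G>. P (n * m))"
  unfolding uprod_eq_ulimit[OF assms]
  by (subst eventually_ulimit[OF F uimage_betaN[OF G]], simp)
     (intro eventually_cong[OF eventually_pos[OF F]], simp add: eventually_uimage[OF G])

lemma ultrafilter_eqI:
  assumes "\<F> \<in> betaN" "\<G> \<in> betaN"
    and "\<And>P. (\<forall>\<^sub>F n in ufilt \<F>. P n) \<longleftrightarrow> (\<forall>\<^sub>F n in ufilt \<G>. P n)"
  shows "\<F> = \<G>"
  using assms by (auto simp: mem_iff_eventually)

lemma uprod_one_right: "\<F> \<in> betaN \<Longrightarrow> \<F> \<odot> principal_uf 1 = \<F>"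
  by (rule ultrafilter_eqI)
     (auto intro!: uprod_betaN principal_uf_betaN
        simp: eventually_uprod principal_uf_betaN eventually_principal_uf)

lemma uprod_one_left: "\<F> \<in> betaN \<Longrightarrow> principal_uf 1 \<odot> \<F> = \<F>"
  by (rule ultrafilter_eqI)
     (auto intro!: uprod_betaN principal_uf_betaN
        simp: eventually_uprod principal_uf_betaN eventually_principal_uf)

section \<open>The inclusions\<close>

lemma div_MI:
  "\<F> \<in> betaN \<Longrightarrow> \<H>1 \<in> betaN \<Longrightarrow> \<H>2 \<in> betaN \<Longrightarrow> (\<F>, \<H>1 \<odot> \<F> \<odot> \<H>2) \<in> div_M"
  by (auto simp: div_M_def intro!: uprod_betaN)

lemma div_L_subset_div_M: "div_L \<subseteq> div_M"
proof clarify
  fix \<F> \<G> assume "(\<F>, \<G>) \<in> div_L"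
  then obtain \<H> where *: "\<F> \<in> betaN" "\<G> \<in> betaN" "\<H> \<in> betaN" "\<G> = \<H> \<odot> \<F>"
    by (auto simp: div_L_def)
  have "(\<F>, \<H> \<odot> \<F> \<odot> principal_uf 1) \<in> div_M"
    using *(1,3) by (intro div_MI principal_uf_betaN) simp_all
  then show "(\<F>, \<G>) \<in> div_M"
    using uprod_one_right[OF *(2)] *(4) by simp
qed

lemma div_R_subset_div_M: "div_R \<subseteq> div_M"
proof clarify
  fix \<F> \<G> assume "(\<F>, \<G>) \<in> div_R"
  then obtain \<H> where *: "\<F> \<in> betaN" "\<H> \<in> betaN" "\<G> = \<F> \<odot> \<H>"
    by (auto simp: div_R_def)
  have "(\<F>, principal_uf 1 \<odot> \<F> \<odot> \<H>) \<in> div_M"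
    using *(1,2) by (intro div_MI principal_uf_betaN) simp_all
  then show "(\<F>, \<G>) \<in> div_M"
    using uprod_one_left[OF *(1)] *(3) by simp
qed

text \<open>Finitely many conditions that each hold for \<open>\<H>\<close>-most \<open>m\<close> hold simultaneously for some \<open>m\<close>;
  this is how the common multiplier in finite embeddability is found.\<close>

lemma fe_setI_eventually:
  assumes H: "\<H> \<in> betaN" and A: "\<And>a. a \<in> A \<Longrightarrow> \<forall>\<^sub>F m in ufilt \<H>. f m * a \<in> B"
    and f: "\<And>m. 0 < m \<Longrightarrow> 0 < f m"
  shows "fe_set A B"
  unfolding fe_set_def
proof (intro allI impI)
  fix F assume F: "finite F \<and> F \<subseteq> A"
  then have "\<forall>\<^sub>F m in ufilt \<H>. \<forall>a\<in>F. f m * a \<in> B"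
    using A by (intro eventually_ball_finite) auto
  with H obtain m where "0 < m" "\<forall>a\<in>F. f m * a \<in> B" by (rule eventually_ufilt_ex)
  then show "\<exists>k\<in>Npos. (\<lambda>a. k * a) ` F \<subseteq> B"
    using f by (intro bexI[of _ "f m"]) (auto simp: Npos_def)
qed

lemma div_M_subset_fe_rel: "div_M \<subseteq> fe_rel"
proof clarify
  fix \<F> \<G> assume "(\<F>, \<G>) \<in> div_M"
  then obtain \<H>1 \<H>2 where FG: "\<F> \<in> betaN" "\<G> \<in> betaN" and H: "\<H>1 \<in> betaN" "\<H>2 \<in> betaN"
    and G: "\<G> = \<H>1 \<odot> \<F> \<odot> \<H>2"
    by (auto simp: div_M_def)
  have "\<exists>A\<in>\<F>. fe_set A B" if "B \<in> \<G>" for B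
  proof -
    have "\<forall>\<^sub>F n in ufilt \<H>1. \<forall>\<^sub>F a in ufilt \<F>. \<forall>\<^sub>F m in ufilt \<H>2. n * a * m \<in> B"
      using that unfolding mem_iff_eventually[OF FG(2)]
      by (simp add: G eventually_uprod uprod_betaN FG H)
    with H(1) obtain n where n: "0 < n" "\<forall>\<^sub>F a in ufilt \<F>. \<forall>\<^sub>F m in ufilt \<H>2. n * a * m \<in> B"
      by (rule eventually_ufilt_ex)
    define A where "A = {a \<in> Npos. \<forall>\<^sub>F m in ufilt \<H>2. n * a * m \<in> B}"
    have "A \<in> \<F>" using n(2) by (simp add: A_def eventually_ufilt[OF FG(1)])
    moreover have "fe_set A B"
      using H(2) n(1) by (intro fe_setI_eventually[where f = "\<lambda>m. n * m"]) (auto simp: A_def mult_ac)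
    ultimately show ?thesis by blast
  qed
  then show "(\<F>, \<G>) \<in> fe_rel" using FG by (auto simp: fe_rel_def)
qed

text \<open>If \<open>up_set A\<close> were missing from \<open>\<G>\<close>, its complement would belong to \<open>\<G>\<close>; but no multiple of
  an element of \<open>A\<close> lies in that complement.\<close>

lemma fe_rel_subset_div_tilde: "fe_rel \<subseteq> div_tilde"
proof clarify
  fix \<F> \<G> assume FG: "(\<F>, \<G>) \<in> fe_rel"
  then have F: "\<F> \<in> betaN" and G: "\<G> \<in> betaN" by (auto simp: fe_rel_def)
  have "up_set A \<in> \<G>" if A: "A \<in> \<F>" for A
  proof (rule ccontr)
    assume "up_set A \<notin> \<G>"
    then have "Npos - up_set A \<in> \<G>"
      by (intro betaND(6)[OF G]) (auto simp: up_set_def)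
    then obtain A' where A': "A' \<in> \<F>" "fe_set A' (Npos - up_set A)"
      using FG by (auto simp: fe_rel_def)
    have "A \<inter> A' \<noteq> {}" using betaND(3,4)[OF F] A A'(1) by metis
    then obtain a where a: "a \<in> A" "a \<in> A'" by blast
    from A'(2) a(2) obtain k where "k * a \<in> Npos - up_set A"
      unfolding fe_set_def by (auto dest!: spec[of _ "{a}"])
    then show False using a(1) by (auto simp: up_set_def)
  qed
  then show "(\<F>, \<G>) \<in> div_tilde" using F G by (auto simp: div_tilde_def)
qed

section \<open>Free ultrafilters on the primes\<close>

text \<open>Zorn's lemma is applied to the families all of whose finite intersections meet \<open>P\<close> in an
  infinite set. A maximal such family contains every set that can be added to it, which makes it an
  ultrafilter: two sets that cannot be added, one the complement of the other, would split an
  infinite set into two finite pieces. Asking for infinite rather than nonempty intersections makes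
  the ultrafilter free.\<close>

lemma free_ultrafilter_exists:
  assumes "infinite P" "P \<subseteq> X"
  obtains U where "ultrafilter_on X U" "P \<in> U" "\<forall>A\<in>U. infinite A"
proof -
  define good where "good S \<longleftrightarrow> S \<subseteq> Pow X \<and> (\<forall>T. finite T \<and> T \<subseteq> S \<longrightarrow> infinite (P \<inter> \<Inter>T))" for S
  have "\<exists>M\<in>Collect good. \<forall>S\<in>Collect good. M \<subseteq> S \<longrightarrow> S = M"
  proof (rule subset_Zorn_nonempty)
    have "good {}" using assms(1) by (auto simp: good_def)
    then show "Collect good \<noteq> {}" by blast
    show "\<Union>\<C> \<in> Collect good" if C: "\<C> \<noteq> {}" "subset.chain (Collect good) \<C>" for \<C>
    proof -
      have good: "good S" if "S \<in> \<C>" for S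
        using C(2) that by (auto simp: subset.chain_def)
      have "infinite (P \<inter> \<Inter>T)" if T: "finite T" "T \<subseteq> \<Union>\<C>" for T
      proof -
        obtain S where "S \<in> \<C>" "T \<subseteq> S"
          using finite_subset_Union_chain[OF T C] .
        then show ?thesis using good T(1) by (simp add: good_def)
      qed
      moreover have "\<Union>\<C> \<subseteq> Pow X"
        using good by (intro Union_least) (simp add: good_def)
      ultimately show ?thesis by (simp add: good_def)
    qed
  qed
  then obtain M where M: "good M" and max: "\<And>S. good S \<Longrightarrow> M \<subseteq> S \<Longrightarrow> S = M" by blast
  have mem: "A \<in> M"
    if "A \<subseteq> X" and inf: "\<And>T. finite T \<Longrightarrow> T \<subseteq> M \<Longrightarrow> infinite (P \<inter> A \<inter> \<Inter>T)" for A
  proof -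
    have "good (insert A M)"
      unfolding good_def
    proof (intro conjI allI impI)
      show "insert A M \<subseteq> Pow X" using M that(1) by (auto simp: good_def)
      fix T assume T: "finite T \<and> T \<subseteq> insert A M"
      have "P \<inter> A \<inter> \<Inter>(T - {A}) \<subseteq> P \<inter> \<Inter>T" by blast
      moreover have "infinite (P \<inter> A \<inter> \<Inter>(T - {A}))" using T by (intro inf) auto
      ultimately show "infinite (P \<inter> \<Inter>T)" using finite_subset by blast
    qed
    then show ?thesis using max[of "insert A M"] by blast
  qed
  have inf: "infinite (P \<inter> \<Inter>T)" if "finite T" "T \<subseteq> M" for T
    using M that by (auto simp: good_def)
  have sub: "A \<subseteq> X" if "A \<in> M" for A using M that by (auto simp: good_def)
  have P: "P \<in> M" using assms inf by (intro mem) auto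
  have infM: "infinite A" if "A \<in> M" for A
    using inf[of "{A}"] that by (auto dest: finite_Int)
  have up: "B \<in> M" if "A \<in> M" "A \<subseteq> B" "B \<subseteq> X" for A B
  proof (rule mem[OF that(3)])
    fix T assume "finite T" "T \<subseteq> M"
    then have "infinite (P \<inter> \<Inter>(insert A T))" using that(1) by (intro inf) auto
    moreover have "P \<inter> \<Inter>(insert A T) \<subseteq> P \<inter> B \<inter> \<Inter>T" using that(2) by auto
    ultimately show "infinite (P \<inter> B \<inter> \<Inter>T)" using finite_subset by blast
  qed
  have int: "A \<inter> B \<in> M" if "A \<in> M" "B \<in> M" for A B
  proof (rule mem)
    fix T assume "finite T" "T \<subseteq> M"
    then have "infinite (P \<inter> \<Inter>(insert A (insert B T)))" using that by (intro inf) auto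
    then show "infinite (P \<inter> (A \<inter> B) \<inter> \<Inter>T)" by (simp add: Int_assoc)
  qed (use sub that in blast)
  have ultra: "A \<in> M \<or> X - A \<in> M" if A: "A \<subseteq> X" for A
  proof (rule ccontr)
    assume "\<not> (A \<in> M \<or> X - A \<in> M)"
    then have notin: "A \<notin> M" "X - A \<notin> M" by simp_all
    obtain T where T: "finite T" "T \<subseteq> M" "finite (P \<inter> A \<inter> \<Inter>T)"
      using mem[OF A] notin(1) by metis
    obtain T' where T': "finite T'" "T' \<subseteq> M" "finite (P \<inter> (X - A) \<inter> \<Inter>T')"
      using mem[OF Diff_subset] notin(2) by metis
    have "P \<inter> \<Inter>(T \<union> T') \<subseteq> (P \<inter> A \<inter> \<Inter>T) \<union> (P \<inter> (X - A) \<inter> \<Inter>T')"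
      using assms(2) by auto
    then have "finite (P \<inter> \<Inter>(T \<union> T'))" using T(3) T'(3) finite_subset by blast
    then show False using inf[of "T \<union> T'"] T T' by auto
  qed
  have "ultrafilter_on X M"
    unfolding ultrafilter_on_def
    using sub up[OF P assms(2)] infM int up ultra by auto
  then show thesis using P infM that by blast
qed

definition free_on_primes :: "nat set set \<Rightarrow> bool" where
  "free_on_primes \<F> \<longleftrightarrow> \<F> \<in> betaN \<and> (\<forall>k. \<forall>\<^sub>F p in ufilt \<F>. prime p \<and> k < p)"

lemma free_on_primes_exists: obtains \<F> where "free_on_primes \<F>"
proof -
  have sub: "{p::nat. prime p} \<subseteq> Npos" by (auto simp: Npos_def prime_gt_0_nat)
  obtain \<F> where F: "ultrafilter_on Npos \<F>" "{p. prime p} \<in> \<F>" "\<forall>A\<in>\<F>. infinite A"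
    by (rule free_ultrafilter_exists[OF primes_infinite sub])
  then have beta: "\<F> \<in> betaN" by (simp add: betaN_def)
  have "\<forall>\<^sub>F p in ufilt \<F>. prime p \<and> k < p" for k
  proof (rule eventually_conj)
    show "\<forall>\<^sub>F p in ufilt \<F>. prime p"
      using F(2) mem_iff_eventually[OF beta] by simp
    have "finite {n \<in> Npos. n \<le> k}" by simp
    then have "{n \<in> Npos. n \<le> k} \<notin> \<F>" using bspec[OF F(3)] by blast
    then have "\<not> (\<forall>\<^sub>F p in ufilt \<F>. p \<le> k)"
      unfolding eventually_ufilt[OF beta] .
    then show "\<forall>\<^sub>F p in ufilt \<F>. k < p"
      by (simp add: eventually_ufilt_not[OF beta, symmetric] not_le)
  qed
  then show thesis using beta that by (auto simp: free_on_primes_def)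
qed

lemma free_on_primesD:
  assumes "free_on_primes \<F>"
  shows "\<F> \<in> betaN" "\<forall>\<^sub>F p in ufilt \<F>. prime p" "\<forall>\<^sub>F p in ufilt \<F>. k < p"
  using assms by (auto simp: free_on_primes_def elim: eventually_mono)

section \<open>Strictness for the one-sided divisibilities\<close>

lemma odd_prime_gt2: "prime (p::nat) \<Longrightarrow> 2 < p \<Longrightarrow> odd p"
  using prime_odd_nat by auto

text \<open>The set \<open>B\<close> below says that the power of 2 was chosen after the other factor. A right factor \<open>\<F>\<close>
  reverses this order: the prime \<open>a\<close> is then chosen after \<open>n\<close>, and \<open>n\<close> alone has to supply the
  power of 2.\<close>

lemma div_R_not_div_L:
  assumes free: "free_on_primes \<F>"
  defines "\<H> \<equiv> uimage ((^) 2) \<F>"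
  shows "(\<F>, \<F> \<odot> \<H>) \<in> div_R" "(\<F>, \<F> \<odot> \<H>) \<notin> div_L"
proof -
  note F = free_on_primesD(1)[OF free]
  have H: "\<H> \<in> betaN" unfolding \<H>_def by (intro uimage_betaN F) simp
  have evH: "(\<forall>\<^sub>F x in ufilt \<H>. Q x) \<longleftrightarrow> (\<forall>\<^sub>F y in ufilt \<F>. Q (2 ^ y))" for Q
    unfolding \<H>_def by (intro eventually_uimage F) simp
  show "(\<F>, \<F> \<odot> \<H>) \<in> div_R" using F H uprod_betaN[OF F H] by (auto simp: div_R_def)
  show "(\<F>, \<F> \<odot> \<H>) \<notin> div_L"
  proof
    assume "(\<F>, \<F> \<odot> \<H>) \<in> div_L"
    then obtain \<H>' where H': "\<H>' \<in> betaN" and eq: "\<F> \<odot> \<H> = \<H>' \<odot> \<F>" by (auto simp: div_L_def)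
    define B where "B x \<longleftrightarrow> (\<exists>a y. x = a * 2 ^ y \<and> a < y)" for x :: nat
    have "\<forall>\<^sub>F a in ufilt \<F>. \<forall>\<^sub>F y in ufilt \<F>. B (a * 2 ^ y)"
    proof (rule always_eventually, rule allI)
      fix a show "\<forall>\<^sub>F y in ufilt \<F>. B (a * 2 ^ y)"
        using free_on_primesD(3)[OF free, of a] by eventually_elim (auto simp: B_def)
    qed
    then have "\<forall>\<^sub>F x in ufilt (\<F> \<odot> \<H>). B x"
      by (simp add: eventually_uprod[OF F H] evH)
    then have "\<forall>\<^sub>F n in ufilt \<H>'. \<forall>\<^sub>F a in ufilt \<F>. B (n * a)"
      unfolding eq by (simp add: eventually_uprod[OF H' F])
    with H' obtain n where n: "0 < n" "\<forall>\<^sub>F a in ufilt \<F>. B (n * a)" by (rule eventually_ufilt_ex)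
    have "\<forall>\<^sub>F a in ufilt \<F>. B (n * a) \<and> prime a \<and> n < a \<and> 2 < a"
      using n(2) free_on_primesD(2,3)[OF free] by (intro eventually_conj)
    with F obtain a where a: "B (n * a)" "prime a" "n < a" "2 < a"
      using eventually_ufilt_ex by blast
    then obtain b y where eq2: "n * a = b * 2 ^ y" "b < y" by (auto simp: B_def)
    \<comment> \<open>The odd prime \<open>a\<close> contributes nothing to the power of 2, so \<open>2 ^ y \<le> n\<close>. Then both factors
       of \<open>b * 2 ^ y\<close> are too small for the product to reach \<open>n * a\<close>.\<close>
    have "coprime (2 ^ y) a" using odd_prime_gt2[OF a(2,4)] by simp
    moreover have "2 ^ y dvd n * a" by (simp add: eq2(1))
    ultimately have "2 ^ y dvd n" by (simp add: coprime_dvd_mult_left_iff)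
    then have y: "2 ^ y \<le> n" using n(1) by (rule dvd_imp_le)
    have "y < 2 ^ y" by (rule less_exp)
    with eq2(2) y a(3) have "b < a" by linarith
    then have "b * 2 ^ y < a * n" using y n(1)
      by (intro mult_less_le_imp_less) auto
    then show False using eq2(1) by (simp add: mult.commute)
  qed
qed

text \<open>The sets \<open>B t\<close> below say that the prime was chosen after the power of 2, and the power of 2 after
  \<open>t\<close>. With \<open>\<F>\<close> as left factor, \<open>\<H>'\<close>-most \<open>m\<close> are powers \<open>2 ^ y\<close> with \<open>y\<close> bounded by a fixed prime
  \<open>a\<close>; taking \<open>t = a\<close> then asks for \<open>y > a\<close>.\<close>

lemma div_L_not_div_R:
  assumes free: "free_on_primes \<F>"
  defines "\<H> \<equiv> uimage ((^) 2) \<F>"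
  shows "(\<F>, \<H> \<odot> \<F>) \<in> div_L" "(\<F>, \<H> \<odot> \<F>) \<notin> div_R"
proof -
  note F = free_on_primesD(1)[OF free]
  have H: "\<H> \<in> betaN" unfolding \<H>_def by (intro uimage_betaN F) simp
  have evH: "(\<forall>\<^sub>F x in ufilt \<H>. Q x) \<longleftrightarrow> (\<forall>\<^sub>F y in ufilt \<F>. Q (2 ^ y))" for Q
    unfolding \<H>_def by (intro eventually_uimage F) simp
  show "(\<F>, \<H> \<odot> \<F>) \<in> div_L" using F H uprod_betaN[OF H F] by (auto simp: div_L_def)
  show "(\<F>, \<H> \<odot> \<F>) \<notin> div_R"
  proof
    assume "(\<F>, \<H> \<odot> \<F>) \<in> div_R"
    then obtain \<H>' where H': "\<H>' \<in> betaN" and eq: "\<H> \<odot> \<F> = \<F> \<odot> \<H>'" by (auto simp: div_R_def)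
    define B where "B t x \<longleftrightarrow> (\<exists>y b. x = 2 ^ y * b \<and> t < y \<and> y < b \<and> prime b)" for t x :: nat
    have B: "\<exists>a. prime a \<and> 2 < a \<and> (\<forall>\<^sub>F m in ufilt \<H>'. B t (a * m) \<and> 0 < m)" for t
    proof -
      have "\<forall>\<^sub>F y in ufilt \<F>. \<forall>\<^sub>F b in ufilt \<F>. B t (2 ^ y * b)"
        using free_on_primesD(3)[OF free, of t]
      proof eventually_elim
        case (elim y)
        show ?case using free_on_primesD(2)[OF free] free_on_primesD(3)[OF free, of y]
          by eventually_elim (use elim in \<open>auto simp: B_def\<close>)
      qed
      then have "\<forall>\<^sub>F x in ufilt (\<H> \<odot> \<F>). B t x"
        by (simp add: eventually_uprod[OF H F] evH)
      then have "\<forall>\<^sub>F a in ufilt \<F>. \<forall>\<^sub>F m in ufilt \<H>'. B t (a * m)"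
        unfolding eq by (simp add: eventually_uprod[OF F H'])
      then have "\<forall>\<^sub>F a in ufilt \<F>. (\<forall>\<^sub>F m in ufilt \<H>'. B t (a * m)) \<and> prime a \<and> 2 < a"
        using free_on_primesD(2,3)[OF free] by (intro eventually_conj)
      with F obtain a where "\<forall>\<^sub>F m in ufilt \<H>'. B t (a * m)" "prime a" "2 < a"
        using eventually_ufilt_ex by blast
      then show ?thesis using eventually_pos[OF H'] by (auto intro: eventually_conj)
    qed
    have odd_part: "\<exists>y. m = 2 ^ y \<and> t < y \<and> y < a" if "B t (a * m)" "prime a" "2 < a" for a m t
    proof -
      obtain y b where yb: "a * m = 2 ^ y * b" "t < y" "y < b" "prime b"
        using \<open>B t (a * m)\<close> by (auto simp: B_def)
      have "\<not> a dvd 2 ^ y"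
        using that(2,3) prime_dvd_power[of a 2 y] dvd_imp_le[of a 2] by auto
      moreover have "a dvd 2 ^ y * b" using yb(1) by (metis dvd_triv_left)
      ultimately have "a dvd b" using that(2) by (simp add: prime_dvd_mult_iff)
      then have "a = b" using that(2) yb(4) by (intro primes_dvd_imp_eq)
      then show ?thesis using yb that(3) by (intro exI[of _ y]) auto
    qed
    obtain a where a: "prime a" "2 < a" "\<forall>\<^sub>F m in ufilt \<H>'. B 0 (a * m) \<and> 0 < m"
      using B[of 0] by blast
    obtain a' where a': "prime a'" "2 < a'" "\<forall>\<^sub>F m in ufilt \<H>'. B a (a' * m) \<and> 0 < m"
      using B[of a] by blast
    obtain m where "B 0 (a * m)" "B a (a' * m)"
      using eventually_ufilt_ex[OF H' eventually_conj[OF a(3) a'(3)]] by blast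
    then obtain y y' where "m = 2 ^ y" "y < a" "m = 2 ^ y'" "a < y'"
      using odd_part a(1,2) a'(1,2) by metis
    then show False by simp
  qed
qed

section \<open>Strictness of two-sided divisibility inside finite embeddability\<close>

text \<open>The limit used below contains every one of these sets: its three quantifiers choose \<open>p\<close>, \<open>a\<close> and
  \<open>y\<close> in this order, each beyond any bound that depends on the earlier choices.\<close>

definition tower :: "nat \<Rightarrow> nat \<Rightarrow> bool" where
  "tower t x \<longleftrightarrow>
     (\<exists>p a y. x = a * p ^ y \<and> prime p \<and> prime a \<and> t < p \<and> p < a \<and> a < y)"

text \<open>In \<open>a * N = b * q ^ y\<close> the prime \<open>a\<close> could be \<open>q\<close> instead of \<open>b\<close>, and one prime \<open>a\<close> cannot rule
  that out. A second, larger prime \<open>a'\<close> can: if \<open>a = q\<close>, then \<open>N\<close> is \<open>b\<close> times a high power of \<open>a\<close>,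
  so that \<open>a' * N\<close> contains, besides this power, two primes \<open>a'\<close> and \<open>b\<close> other than \<open>a\<close>, where a
  tower has room for only one.\<close>

lemma tower_cofactor:
  assumes N: "tower t (a * N)" "tower t (a' * N)" and a: "prime a" "prime a'" "a < a'"
  shows "\<exists>q y. N = q ^ y \<and> prime q \<and> t < q \<and> q < a \<and> a < y"
proof -
  obtain q b y where q: "a * N = b * q ^ y" "prime q" "prime b" "t < q" "q < b" "b < y"
    using N(1) by (auto simp: tower_def)
  obtain q' b' y' where q': "a' * N = b' * q' ^ y'" "prime q'" "prime b'" "t < q'" "q' < b'" "b' < y'"
    using N(2) by (auto simp: tower_def)
  show ?thesis
  proof (cases "a = b")
    case True
    then have "N = q ^ y" using q(1) a(1) by simp
    then show ?thesis using q True by blast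
  next
    case False
    have "a dvd b * q ^ y" using q(1) by (metis dvd_triv_left)
    then have "a dvd q ^ y" using False a(1) q(3)
      by (auto simp: prime_dvd_mult_iff dest: primes_dvd_imp_eq)
    then have "a = q" using a(1) q(2) prime_dvd_power primes_dvd_imp_eq by blast
    have "3 \<le> y" using q(5,6) prime_ge_2_nat[OF q(2)] by linarith
    then obtain z where z: "y = Suc (z + 2)"
      by (auto dest!: le_Suc_ex)
    have N_eq: "N = b * a ^ (z + 2)"
      using q(1) a(1) by (simp add: \<open>a = q\<close> z)
    have prod: "a' * (b * a ^ (z + 2)) = b' * q' ^ y'" using q'(1) by (simp add: N_eq)
    have "a = q'"
    proof (rule ccontr)
      assume "a \<noteq> q'"
      then have "coprime (a ^ 2) (q' ^ y')"
        using a(1) q'(2) by (simp add: primes_coprime)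
      moreover have "a ^ 2 dvd b' * q' ^ y'"
        unfolding prod[symmetric] power_add by (intro dvd_mult) simp
      ultimately have dvd: "a ^ 2 dvd b'" by (simp add: coprime_dvd_mult_left_iff)
      then have "a dvd b'" by (simp add: power2_eq_square dvd_mult_left)
      then have "a = b'" using a(1) q'(3) by (intro primes_dvd_imp_eq)
      then show False using dvd a(1) by (simp add: power2_eq_square)
    qed
    have "coprime a' (a ^ y')" "coprime b (a ^ y')"
      using a q(3,5) by (simp_all add: primes_coprime \<open>a = q\<close>)
    then have "coprime (a' * b) (a ^ y')" by auto
    moreover have "a' * b dvd b' * a ^ y'"
      using prod unfolding \<open>a = q'\<close> by (metis dvd_triv_left mult.assoc)
    ultimately have dvd: "a' * b dvd b'" by (simp add: coprime_dvd_mult_left_iff)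
    then have "a' = b'" "b = b'"
      using a(2) q(3) q'(3) by (auto intro!: primes_dvd_imp_eq dest: dvd_mult_left dvd_mult_right)
    with dvd q'(3) have False by (simp add: prime_gt_0_nat)
    then show ?thesis ..
  qed
qed

text \<open>The exponent \<open>y\<close> is chosen after \<open>a\<close>, so \<open>p ^ y\<close> serves as common multiplier for finitely
  many \<open>a\<close>; this gives finite embeddability. Two-sided divisibility fails because the base \<open>p\<close> varies
  unboundedly while the exponent belongs to the last factor: the powers of \<open>p\<close> would have to
  come from \<open>\<H>2\<close>, which can concentrate on the powers of one base only.\<close>

lemma fe_rel_not_div_M:
  assumes free: "free_on_primes \<F>"
  defines "\<G> \<equiv> ulimit \<F> (\<lambda>p. \<F> \<odot> uimage ((^) p) \<F>)"
  shows "(\<F>, \<G>) \<in> fe_rel" "(\<F>, \<G>) \<notin> div_M"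
proof -
  note F = free_on_primesD(1)[OF free]
  have I: "uimage ((^) p) \<F> \<in> betaN" if "0 < p" for p
    using that by (intro uimage_betaN F) simp
  have FI: "\<F> \<odot> uimage ((^) p) \<F> \<in> betaN" if "0 < p" for p
    using that by (intro uprod_betaN F I)
  have G: "\<G> \<in> betaN" unfolding \<G>_def by (intro ulimit_betaN F FI)
  have evG: "(\<forall>\<^sub>F x in ufilt \<G>. Q x) \<longleftrightarrow>
      (\<forall>\<^sub>F p in ufilt \<F>. \<forall>\<^sub>F a in ufilt \<F>. \<forall>\<^sub>F y in ufilt \<F>. Q (a * p ^ y))" for Q
    unfolding \<G>_def
    by (subst eventually_ulimit[OF F FI], assumption)
       (intro eventually_cong[OF eventually_pos[OF F]],
        simp add: eventually_uprod[OF F I] eventually_uimage[OF F])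
  have "\<exists>A\<in>\<F>. fe_set A B" if "B \<in> \<G>" for B
  proof -
    have "\<forall>\<^sub>F p in ufilt \<F>. \<forall>\<^sub>F a in ufilt \<F>. \<forall>\<^sub>F y in ufilt \<F>. a * p ^ y \<in> B"
      using that unfolding mem_iff_eventually[OF G] evG by blast
    with F obtain p where p: "0 < p" "\<forall>\<^sub>F a in ufilt \<F>. \<forall>\<^sub>F y in ufilt \<F>. a * p ^ y \<in> B"
      by (rule eventually_ufilt_ex)
    define A where "A = {a \<in> Npos. \<forall>\<^sub>F y in ufilt \<F>. a * p ^ y \<in> B}"
    have "A \<in> \<F>" using p(2) by (simp add: A_def eventually_ufilt[OF F])
    moreover have "fe_set A B"
      using F p(1) by (intro fe_setI_eventually[where f = "\<lambda>y. p ^ y"]) (auto simp: A_def mult_ac)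
    ultimately show ?thesis by blast
  qed
  then show "(\<F>, \<G>) \<in> fe_rel" using F G by (auto simp: fe_rel_def)
  show "(\<F>, \<G>) \<notin> div_M"
  proof
    assume "(\<F>, \<G>) \<in> div_M"
    then obtain \<H>1 \<H>2 where H: "\<H>1 \<in> betaN" "\<H>2 \<in> betaN" and eq: "\<G> = \<H>1 \<odot> \<F> \<odot> \<H>2"
      by (auto simp: div_M_def)
    have main: "\<exists>q>t. prime q \<and> (\<forall>\<^sub>F m in ufilt \<H>2. 1 < m \<and> (\<exists>y. m dvd q ^ y))" for t
    proof -
      have "\<forall>\<^sub>F p in ufilt \<F>. \<forall>\<^sub>F a in ufilt \<F>. \<forall>\<^sub>F y in ufilt \<F>. tower t (a * p ^ y)"
        using free_on_primesD(2)[OF free] free_on_primesD(3)[OF free, of t]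
      proof eventually_elim
        case p: (elim p)
        show ?case using free_on_primesD(2)[OF free] free_on_primesD(3)[OF free, of p]
        proof eventually_elim
          case a: (elim a)
          show ?case using free_on_primesD(3)[OF free, of a]
            by eventually_elim (use p a in \<open>auto simp: tower_def\<close>)
        qed
      qed
      then have "\<forall>\<^sub>F x in ufilt \<G>. tower t x" by (simp add: evG)
      then have "\<forall>\<^sub>F n in ufilt \<H>1. \<forall>\<^sub>F a in ufilt \<F>. \<forall>\<^sub>F m in ufilt \<H>2. tower t (n * a * m)"
        unfolding eq by (simp add: eventually_uprod uprod_betaN F H)
      with H(1) obtain n where n: "0 < n"
        "\<forall>\<^sub>F a in ufilt \<F>. \<forall>\<^sub>F m in ufilt \<H>2. tower t (n * a * m)"
        by (rule eventually_ufilt_ex)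
      have "\<exists>a. (\<forall>\<^sub>F m in ufilt \<H>2. tower t (n * a * m)) \<and> prime a \<and> k < a" for k
      proof -
        have "\<forall>\<^sub>F a in ufilt \<F>. (\<forall>\<^sub>F m in ufilt \<H>2. tower t (n * a * m)) \<and> prime a \<and> k < a"
          using n(2) free_on_primesD(2,3)[OF free] by (intro eventually_conj)
        with F show ?thesis using eventually_ufilt_ex by blast
      qed
      then obtain a a' where a: "\<forall>\<^sub>F m in ufilt \<H>2. tower t (n * a * m)" "prime a" "n < a"
        and a': "\<forall>\<^sub>F m in ufilt \<H>2. tower t (n * a' * m)" "prime a'" "a < a'"
        by metis
      have "\<forall>\<^sub>F m in ufilt \<H>2. \<exists>q\<in>{..<a}. \<exists>y. n * m = q ^ y \<and> prime q \<and> t < q \<and> a < y"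
        using a(1) a'(1)
      proof eventually_elim
        case (elim m)
        then have "tower t (a * (n * m))" "tower t (a' * (n * m))" by (simp_all add: mult_ac)
        from tower_cofactor[OF this a(2) a'(2,3)] show ?case by auto
      qed
      \<comment> \<open>The bound \<open>q < a\<close> leaves finitely many bases, so one of them works for \<open>\<H>2\<close>-most \<open>m\<close>.\<close>
      with H(2) finite_lessThan obtain q where
        q: "\<forall>\<^sub>F m in ufilt \<H>2. \<exists>y. n * m = q ^ y \<and> prime q \<and> t < q \<and> a < y"
        by (rule eventually_ufilt_bex_finite)
      then have "prime q" "t < q" using eventually_ufilt_ex[OF H(2)] by blast+
      moreover from q have "\<forall>\<^sub>F m in ufilt \<H>2. 1 < m \<and> (\<exists>y. m dvd q ^ y)"
      proof eventually_elim
        case (elim m)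
        then obtain y where y: "n * m = q ^ y" "a < y" by blast
        \<comment> \<open>As \<open>n < a < y\<close>, the number \<open>n\<close> is too small to be all of \<open>q ^ y\<close>.\<close>
        have "y < q ^ y" using \<open>prime q\<close> by (intro power_gt_expt) (simp add: prime_gt_Suc_0_nat)
        with y a(3) have "n * 1 < n * m" by simp
        then have "1 < m" by (rule mult_less_cancel1[THEN iffD1, THEN conjunct2])
        then show ?case using y(1) by (metis dvd_triv_right)
      qed
      ultimately show ?thesis by blast
    qed
    obtain q where q: "prime q" "\<forall>\<^sub>F m in ufilt \<H>2. 1 < m \<and> (\<exists>y. m dvd q ^ y)"
      using main[of 0] by blast
    obtain q' where q': "q < q'" "prime q'" "\<forall>\<^sub>F m in ufilt \<H>2. 1 < m \<and> (\<exists>y. m dvd q' ^ y)"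
      using main[of q] by blast
    obtain m y y' where m: "1 < m" "m dvd q ^ y" "m dvd q' ^ y'"
      using eventually_ufilt_ex[OF H(2) eventually_conj[OF q(2) q'(3)]] by blast
    have "coprime (q ^ y) (q' ^ y')"
      using q(1) q'(1,2) by (simp add: primes_coprime)
    then have "m dvd 1" using m(2,3) coprime_common_divisor_nat by fastforce
    then show False using m(1) by simp
  qed
qed

section \<open>Strictness of finite embeddability inside tilde-divisibility\<close>

text \<open>Each prime divides its square, but a multiplier that takes a prime to the square of a prime is
  that prime itself, so no multiplier serves two primes at once.\<close>

lemma div_tilde_not_fe_rel:
  assumes free: "free_on_primes \<F>"
  defines "\<G> \<equiv> uimage (\<lambda>n. n ^ 2) \<F>"
  shows "(\<F>, \<G>) \<in> div_tilde" "(\<F>, \<G>) \<notin> fe_rel"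
proof -
  note F = free_on_primesD(1)[OF free]
  have G: "\<G> \<in> betaN" unfolding \<G>_def by (intro uimage_betaN F) simp
  have evG: "(\<forall>\<^sub>F x in ufilt \<G>. Q x) \<longleftrightarrow> (\<forall>\<^sub>F p in ufilt \<F>. Q (p ^ 2))" for Q
    unfolding \<G>_def by (intro eventually_uimage F) simp
  have "up_set A \<in> \<G>" if "A \<in> \<F>" for A
  proof -
    have multiple: "p ^ 2 \<in> up_set A" if "p \<in> A" "0 < p" for p
      using that unfolding up_set_def Npos_def by (auto intro!: bexI[of _ p])
    have "\<forall>\<^sub>F p in ufilt \<F>. p \<in> A" using that by (simp add: mem_iff_eventually[OF F])
    then have "\<forall>\<^sub>F p in ufilt \<F>. p ^ 2 \<in> up_set A" using eventually_pos[OF F]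
      by eventually_elim (rule multiple)
    then show ?thesis unfolding mem_iff_eventually[OF G] evG by (auto simp: up_set_def)
  qed
  then show "(\<F>, \<G>) \<in> div_tilde" using F G by (auto simp: div_tilde_def)
  show "(\<F>, \<G>) \<notin> fe_rel"
  proof
    assume "(\<F>, \<G>) \<in> fe_rel"
    moreover define B where "B = {p ^ 2 | p :: nat. prime p}"
    have "B \<in> \<G>" unfolding mem_iff_eventually[OF G] evG
      using free_on_primesD(2)[OF free]
      by (auto simp: B_def Npos_def prime_gt_0_nat elim!: eventually_mono)
    ultimately obtain A where A: "A \<in> \<F>" "fe_set A B" by (auto simp: fe_rel_def)
    have "\<exists>p. p \<in> A \<and> prime p \<and> k < p" for k
    proof -
      have "\<forall>\<^sub>F p in ufilt \<F>. p \<in> A \<and> prime p \<and> k < p"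
        using A(1) free_on_primesD(2,3)[OF free] mem_iff_eventually[OF F]
        by (intro eventually_conj) auto
      with F show ?thesis using eventually_ufilt_ex by blast
    qed
    then obtain p q where pq: "p \<in> A" "prime p" "q \<in> A" "prime q" "p < q" by metis
    then obtain k where k: "k * p \<in> B" "k * q \<in> B"
      using A(2) unfolding fe_set_def by (auto dest!: spec[of _ "{p, q}"])
    have *: "k = r" if "k * r \<in> B" "prime r" for r
    proof -
      obtain s where s: "k * r = s ^ 2" "prime s"
        using \<open>k * r \<in> B\<close> by (auto simp: B_def)
      then have "r dvd s" using that(2) prime_dvd_power by (metis dvd_triv_right)
      then have "r = s" using that(2) s(2) by (intro primes_dvd_imp_eq)
      then show ?thesis using s(1) that(2) by (simp add: power2_eq_square)
    qed
    show False using *[OF k(1) pq(2)] *[OF k(2) pq(4)] pq(5) by simp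
  qed
qed

theorem theorem2p8:
  shows "div_L \<subset> div_M \<and> div_R \<subset> div_M \<and> div_M \<subset> fe_rel \<and> fe_rel \<subset> div_tilde"
proof -
  obtain \<F> where F: "free_on_primes \<F>" by (rule free_on_primes_exists)
  show ?thesis
    using div_L_subset_div_M div_R_subset_div_M div_M_subset_fe_rel fe_rel_subset_div_tilde
      div_R_not_div_L[OF F] div_L_not_div_R[OF F] fe_rel_not_div_M[OF F] div_tilde_not_fe_rel[OF F]
    by blast
qed

end
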